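(* Let $f,g$ be holomorphic on the open unit disc $\mathbb{D}$, and let $C_1,C_2$ be two distinct circles contained in $\mathbb{D}$, bounding open discs $D_1$ and $D_2$ respectively, such that $|f|=|g|$ on $C_1\cup C_2$. Suppose (possibly after swapping the roles of $C_1$ and $C_2$) that one of the following holds: (1) $C_1$ and $C_2$ are disjoint with $C_2\subset D_1$; (2) $C_1$ and $C_2$ are disjoint with $C_2\subset\mathbb{D}\setminus\overline{D_1}$; (3) $C_1$ and $C_2$ are tangent with $C_2\subset\overline{D_1}$; (4) $C_1$ and $C_2$ are tangent with $C_2\subset\mathbb{D}\setminus D_1$; (5) $C_1$ and $C_2$ intersect in two points, at which they make an angle $\theta\in(0,\pi/2]$. Then in cases (1)–(4), $f=cg$ for some $c$ with $|c|=1$; in case (5) the same conclusion holds if $\theta$ is an irrational multiple of $\pi$. Moreover, if $\theta$ is a rational multiple of $\pi$ the conclusion need not hold in case (5): there exist circles $C_1,C_2\subset\mathbb{D}$ as in (5) with such an angle and holomorphic $f,g$ on $\mathbb{D}$ with $|f|=|g|$ on $C_1\cup C_2$ but $f\neq cg$ for every $c$ with $|c|=1$. *)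

theory Defs
  imports "HOL-Complex_Analysis.Complex_Analysis"
begin

text \<open>A circle is represented by its centre a and radius r > 0; the circle itself
is sphere a r, the open disc it bounds is ball a r, its closure is cball a r.
The open unit disc is ball 0 1.\<close>

definition circle_in_disc :: "complex \<Rightarrow> real \<Rightarrow> bool" where
  "circle_in_disc a r \<longleftrightarrow> r > 0 \<and> sphere a r \<subseteq> ball 0 1"

definition circles_disjoint :: "complex \<Rightarrow> real \<Rightarrow> complex \<Rightarrow> real \<Rightarrow> bool" where
  "circles_disjoint a1 r1 a2 r2 \<longleftrightarrow> sphere a1 r1 \<inter> sphere a2 r2 = {}"

definition circles_tangent :: "complex \<Rightarrow> real \<Rightarrow> complex \<Rightarrow> real \<Rightarrow> bool" where
  "circles_tangent a1 r1 a2 r2 \<longleftrightarrow> card (sphere a1 r1 \<inter> sphere a2 r2) = 1"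

definition circles_two_points :: "complex \<Rightarrow> real \<Rightarrow> complex \<Rightarrow> real \<Rightarrow> bool" where
  "circles_two_points a1 r1 a2 r2 \<longleftrightarrow> card (sphere a1 r1 \<inter> sphere a2 r2) = 2"

text \<open>Angle (in [0, pi/2]) between two circles at a common point p: the angle between
the tangent lines there, which equals the (non-obtuse) angle between the radius lines
p - a1 and p - a2.\<close>
definition circle_angle :: "complex \<Rightarrow> real \<Rightarrow> complex \<Rightarrow> real \<Rightarrow> complex \<Rightarrow> real" where
  "circle_angle a1 r1 a2 r2 p =
     arccos (\<bar>Re ((p - a1) * cnj (p - a2))\<bar> / (r1 * r2))"

definition config1 :: "complex \<Rightarrow> real \<Rightarrow> complex \<Rightarrow> real \<Rightarrow> bool" where
  "config1 a1 r1 a2 r2 \<longleftrightarrow> circles_disjoint a1 r1 a2 r2 \<and> sphere a2 r2 \<subseteq> ball a1 r1"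

definition config2 :: "complex \<Rightarrow> real \<Rightarrow> complex \<Rightarrow> real \<Rightarrow> bool" where
  "config2 a1 r1 a2 r2 \<longleftrightarrow> circles_disjoint a1 r1 a2 r2 \<and>
     sphere a2 r2 \<subseteq> ball 0 1 - cball a1 r1"

definition config3 :: "complex \<Rightarrow> real \<Rightarrow> complex \<Rightarrow> real \<Rightarrow> bool" where
  "config3 a1 r1 a2 r2 \<longleftrightarrow> circles_tangent a1 r1 a2 r2 \<and> sphere a2 r2 \<subseteq> cball a1 r1"

definition config4 :: "complex \<Rightarrow> real \<Rightarrow> complex \<Rightarrow> real \<Rightarrow> bool" where
  "config4 a1 r1 a2 r2 \<longleftrightarrow> circles_tangent a1 r1 a2 r2 \<and>
     sphere a2 r2 \<subseteq> ball 0 1 - ball a1 r1"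

definition config5 :: "complex \<Rightarrow> real \<Rightarrow> complex \<Rightarrow> real \<Rightarrow> real \<Rightarrow> bool" where
  "config5 a1 r1 a2 r2 \<theta> \<longleftrightarrow> circles_two_points a1 r1 a2 r2 \<and> \<theta> \<in> {0<..pi/2} \<and>
     (\<forall>p \<in> sphere a1 r1 \<inter> sphere a2 r2. circle_angle a1 r1 a2 r2 p = \<theta>)"

definition unimodular_multiple :: "(complex \<Rightarrow> complex) \<Rightarrow> (complex \<Rightarrow> complex) \<Rightarrow> bool" where
  "unimodular_multiple f g \<longleftrightarrow> (\<exists>c. norm c = 1 \<and> (\<forall>z \<in> ball 0 1. f z = c * g z))"

end

theory Submission
  imports Defs
begin

text \<open>
  The zeros of \<open>f\<close> and \<open>g\<close> inside the first circle can be traded for Blaschke factors; what is left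
  is zero-free with equal moduli on the circle, so the maximum principle makes it proportional.
  Hence \<open>f / g\<close> is a rational function \<open>P / Q\<close>, unimodular on both circles. By Schwarz reflection it is
  invariant under the composition \<open>T\<close> of the two inversions. If \<open>T\<close> has an infinite orbit, then \<open>P / Q\<close>
  takes one value infinitely often and is constant.

  With \<open>\<tau> = (r\<^sub>1\<^sup>2 + r\<^sub>2\<^sup>2 - d\<^sup>2) / (2 r\<^sub>1 r\<^sub>2)\<close>, where \<open>d\<close> is the distance of the centres, \<open>T\<close> acts on the
  line of centres as a Moebius map of determinant 1 and trace \<open>2 \<tau>\<close>. The orbit of infinity under such
  a map is governed by the Chebyshev polynomials of the second kind, and it is infinite iff none of them
  vanishes at \<open>\<tau>\<close>. This is so for \<open>\<bar>\<tau>\<bar> \<ge> 1\<close> (circles not crossing), and for \<open>\<tau> = cos \<phi>\<close> with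
  \<open>\<phi> / \<pi>\<close> irrational.

  If \<open>\<theta> = m \<pi> / q\<close>, send the intersection points to 0 and infinity, so that the circles become
  lines through 0 which \<open>w \<mapsto> w ^ q\<close> maps into the real axis; then \<open>(w ^ q - \<i>) / (w ^ q + \<i>)\<close> is
  unimodular on both.
\<close>

section \<open>Polynomials with equal moduli on two circles\<close>

text \<open>Since \<open>x / 0 = 0\<close>, the centre is a fixed point, and the inversion is an involution of the whole
  plane.\<close>

definition circle_reflection :: "complex \<Rightarrow> real \<Rightarrow> complex \<Rightarrow> complex" where
  "circle_reflection a r z = a + of_real (r\<^sup>2) / cnj (z - a)"

lemma circle_reflection_involutive:
  assumes "r > 0"
  shows "circle_reflection a r (circle_reflection a r z) = z"
  using assms by (cases "z = a") (simp_all add: circle_reflection_def)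

lemma inj_circle_reflection: "r > 0 \<Longrightarrow> inj (circle_reflection a r)"
  by (metis circle_reflection_involutive injI)

lemma circle_reflection_sphere:
  assumes "r > 0" "z \<in> sphere a r"
  shows "circle_reflection a r z = z"
proof -
  have n: "norm (z - a) = r"
    using assms by (simp add: dist_norm norm_minus_commute)
  then have "(z - a) * cnj (z - a) = of_real (r\<^sup>2)"
    by (metis complex_norm_square of_real_power)
  moreover have "cnj (z - a) \<noteq> 0"
    using n assms by auto
  ultimately show ?thesis
    unfolding circle_reflection_def by (metis add_diff_cancel_left' diff_add_cancel add.commute nonzero_mult_div_cancel_right)
qed

section \<open>Limit points and continuity on a circle\<close>

lemma sphere_islimpt:
  fixes a :: complex
  assumes "r > 0" "z \<in> sphere a r"
  shows "z islimpt sphere a r"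
proof (rule connected_imp_perfect)
  show "connected (sphere a r)"
    by (rule connected_sphere) simp
  have "a + of_real r \<in> sphere a r" "a - of_real r \<in> sphere a r"
    using assms by (auto simp: dist_norm)
  moreover have "a + of_real r \<noteq> a - of_real r"
    using assms by (auto simp: complex_eq_iff)
  ultimately show "sphere a r \<noteq> {x}" for x
    by (metis singletonD)
qed (use assms in auto)

text \<open>A circle has no isolated points, so what remains after removing finitely many is still
  dense in it. This recovers an equality of norms at zeros that had to be avoided in a
  cancellation.\<close>

lemma continuous_eq_on_sphere_if_cofinite:
  fixes \<phi> \<psi> :: "complex \<Rightarrow> real"
  assumes "r > 0" "finite F" "continuous_on (sphere a r) \<phi>" "continuous_on (sphere a r) \<psi>"
    and eq: "\<And>z. z \<in> sphere a r - F \<Longrightarrow> \<phi> z = \<psi> z" and z: "z \<in> sphere a r"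
  shows "\<phi> z = \<psi> z"
proof -
  have "z islimpt sphere a r - F"
    using sphere_islimpt[OF \<open>r > 0\<close> z] \<open>finite F\<close>
    by (metis Un_Diff_cancel2 islimpt_Un islimpt_finite)
  then have "at z within (sphere a r - F) \<noteq> bot"
    by (simp add: trivial_limit_within)
  moreover have "(\<phi> \<longlongrightarrow> \<phi> z) (at z within (sphere a r - F))" "(\<psi> \<longlongrightarrow> \<psi> z) (at z within (sphere a r - F))"
    using assms(3,4) z by (auto simp: continuous_on_def intro: tendsto_within_subset)
  moreover have "eventually (\<lambda>x. \<phi> x = \<psi> x) (at z within (sphere a r - F))"
    using eq by (auto simp: eventually_at_filter)
  ultimately show ?thesis
    by (metis tendsto_cong tendsto_unique)
qed

text \<open>Schwarz reflection without denominators. On the circle the inversion is the identity and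
  both sides are squared norms; both extend holomorphically to the punctured plane, so the identity
  theorem applies.\<close>

lemma poly_reflection_identity:
  assumes r: "r > 0" and eq: "\<And>z. z \<in> sphere a r \<Longrightarrow> norm (poly P z) = norm (poly Q z)"
    and z: "z \<noteq> a"
  shows "poly P z * cnj (poly P (circle_reflection a r z))
       = poly Q z * cnj (poly Q (circle_reflection a r z))"
proof -
  \<comment> \<open>Conjugating the coefficients and the argument separately cancels the
    conjugations, so that holomorphy in \<open>w\<close> becomes visible.\<close>
  define H where "H R w = poly R w * poly (map_poly cnj R) (cnj a + of_real (r\<^sup>2) / (w - a))" for R w
  have H: "H R w = poly R w * cnj (poly R (circle_reflection a r w))" for R w
    unfolding H_def circle_reflection_def by (subst poly_cnj) simp
  have "H P z - H Q z = 0"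
  proof (rule analytic_continuation[where f = "\<lambda>w. H P w - H Q w" and S = "-{a}" and U = "sphere a r"
        and \<xi> = "a + of_real r"])
    show "(\<lambda>w. H P w - H Q w) holomorphic_on -{a}"
      unfolding H_def by (intro holomorphic_intros poly_holomorphic_on) auto
    show "connected (- {a})"
      by (rule connected_punctured_universe) simp
    show "a + of_real r islimpt sphere a r"
      by (rule sphere_islimpt) (use r in \<open>auto simp: dist_norm\<close>)
    show "H P w - H Q w = 0" if "w \<in> sphere a r" for w
      using eq[OF that] by (simp add: H circle_reflection_sphere[OF r that] flip: complex_norm_square)
  qed (use r z in auto)
  then show ?thesis
    by (simp add: H)
qed

text \<open>The reflection identity at \<open>x n\<close> for the first circle and at
  \<open>y n\<close> for the second gives \<open>P / Q\<close> the same value at \<open>x n\<close>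
  and \<open>x (Suc n)\<close>. The recursion is asked only eventually, because an orbit may hit a
  centre, where the inversion takes its conventional value.\<close>

lemma poly_unimodular_multiple_if_orbit:
  assumes r: "r1 > 0" "r2 > 0" and "P \<noteq> 0" "Q \<noteq> 0"
    and eq1: "\<And>z. z \<in> sphere a1 r1 \<Longrightarrow> norm (poly P z) = norm (poly Q z)"
    and eq2: "\<And>z. z \<in> sphere a2 r2 \<Longrightarrow> norm (poly P z) = norm (poly Q z)"
    and x: "inj x"
    and step: "\<forall>\<^sub>F n in sequentially. x (Suc n) = circle_reflection a2 r2 (circle_reflection a1 r1 (x n))"
  shows "\<exists>c. norm c = 1 \<and> P = smult c Q"
proof -
  let ?h = "\<lambda>z. poly P z / poly Q z"
  define y where "y n = circle_reflection a1 r1 (x n)" for n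
  have y: "inj y"
    unfolding y_def using inj_compose[OF inj_circle_reflection[OF r(1)] x] by (simp add: comp_def)
  \<comment> \<open>At roots the quotient or its reciprocal breaks down, at the centres the
    reflection identity. An injective sequence leaves this finite set for good.\<close>
  define B where "B = {z. poly P z = 0} \<union> {z. poly Q z = 0} \<union> {a1, a2}"
  have B: "finite B"
    unfolding B_def using \<open>P \<noteq> 0\<close> \<open>Q \<noteq> 0\<close> by (auto intro: poly_roots_finite)
  have avoid: "\<forall>\<^sub>F n in sequentially. s n \<notin> B" if "inj s" for s :: "nat \<Rightarrow> complex"
    using finite_vimageI[OF B that] by (simp add: eventually_cofinite vimage_def flip: cofinite_eq_sequentially)
  have "\<forall>\<^sub>F n in sequentially. x n \<notin> B \<and> y n \<notin> B \<and> x (Suc n) = circle_reflection a2 r2 (y n)"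
    using avoid[OF x] avoid[OF y] step unfolding y_def by eventually_elim auto
  then obtain N where N: "\<And>n. n \<ge> N \<Longrightarrow> x n \<notin> B \<and> y n \<notin> B \<and> x (Suc n) = circle_reflection a2 r2 (y n)"
    by (auto simp: eventually_sequentially)
  have invariant: "?h (x (Suc n)) = ?h (x n)" if "n \<ge> N" for n
  proof -
    have nz: "poly P (x n) \<noteq> 0" "poly Q (x n) \<noteq> 0" "poly P (y n) \<noteq> 0" "poly Q (y n) \<noteq> 0"
      "poly P (x (Suc n)) \<noteq> 0" "poly Q (x (Suc n)) \<noteq> 0" "x n \<noteq> a1" "y n \<noteq> a2"
      using N[of n] N[of "Suc n"] that by (auto simp: B_def)
    have 1: "poly P (x n) * cnj (poly P (y n)) = poly Q (x n) * cnj (poly Q (y n))"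
      unfolding y_def by (rule poly_reflection_identity[OF r(1) eq1 nz(7)])
    have "poly P (y n) * cnj (poly P (x (Suc n))) = poly Q (y n) * cnj (poly Q (x (Suc n)))"
      using N[OF that] poly_reflection_identity[OF r(2) eq2 nz(8)] by simp
    then have "cnj (poly P (y n) * cnj (poly P (x (Suc n)))) = cnj (poly Q (y n) * cnj (poly Q (x (Suc n))))"
      by (rule arg_cong)
    then have 2: "cnj (poly P (y n)) * poly P (x (Suc n)) = cnj (poly Q (y n)) * poly Q (x (Suc n))"
      by simp
    have "?h (x n) = cnj (poly Q (y n)) / cnj (poly P (y n))"
      using 1 nz by (simp add: frac_eq_eq mult_ac)
    moreover have "?h (x (Suc n)) = cnj (poly Q (y n)) / cnj (poly P (y n))"
      using 2 nz by (simp add: frac_eq_eq mult_ac)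
    ultimately show ?thesis
      by simp
  qed
  define c where "c = ?h (x N)"
  have c: "?h (x n) = c" if "n \<ge> N" for n
    using that by (induction n rule: dec_induct) (simp_all add: c_def invariant)
  have "P - smult c Q = 0"
  proof (rule ccontr)
    assume "P - smult c Q \<noteq> 0"
    then have "finite {z. poly (P - smult c Q) z = 0}"
      by (rule poly_roots_finite)
    moreover have "x ` {N..} \<subseteq> {z. poly (P - smult c Q) z = 0}"
      using c N by (auto simp: B_def field_simps)
    ultimately have "finite {N..}"
      using finite_subset finite_imageD inj_on_subset[OF x] by (metis subset_UNIV)
    then show False
      by (simp add: infinite_Ici)
  qed
  then have P: "P = smult c Q"
    by simp
  have "infinite (sphere a1 r1)"
    using islimpt_finite sphere_islimpt[OF r(1), of "a1 + of_real r1" a1] r by (auto simp: dist_norm)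
  then obtain z where "z \<in> sphere a1 r1" "poly Q z \<noteq> 0"
    using poly_roots_finite[OF \<open>Q \<noteq> 0\<close>] by (metis (mono_tags, lifting) finite_subset mem_Collect_eq subsetI)
  then have "norm c = 1"
    using eq1[of z] unfolding P by (simp add: norm_mult)
  with P show ?thesis
    by blast
qed

section \<open>Infinite orbits of the composed inversions\<close>

text \<open>\<open>cheb \<tau> n\<close> is the value \<open>U\<^bsub>n-1\<^esub>(\<tau>)\<close> of the Chebyshev polynomial of the second kind.\<close>

fun cheb :: "real \<Rightarrow> nat \<Rightarrow> real" where
  "cheb \<tau> 0 = 0"
| "cheb \<tau> (Suc 0) = 1"
| "cheb \<tau> (Suc (Suc n)) = 2 * \<tau> * cheb \<tau> (Suc n) - cheb \<tau> n"

text \<open>The recursion gives \<open>\<bar>cheb \<tau> (n + 2)\<bar> \<ge> 2 * \<bar>cheb \<tau>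
  (n + 1)\<bar> - \<bar>cheb \<tau> n\<bar>\<close>, so each increment is at least the previous
  one.\<close>

lemma cheb_abs_increasing:
  assumes "\<bar>\<tau>\<bar> \<ge> 1"
  shows "\<bar>cheb \<tau> n\<bar> < \<bar>cheb \<tau> (Suc n)\<bar>"
proof (induction n)
  case (Suc n)
  have "2 * \<bar>cheb \<tau> (Suc n)\<bar> \<le> 2 * \<bar>\<tau>\<bar> * \<bar>cheb \<tau> (Suc n)\<bar>"
    using mult_right_mono[OF assms, of "2 * \<bar>cheb \<tau> (Suc n)\<bar>"] by (simp add: mult_ac)
  also have "\<dots> = \<bar>2 * \<tau> * cheb \<tau> (Suc n)\<bar>"
    by (simp add: abs_mult)
  finally show ?case
    using Suc by simp
qed simp

lemma cheb_cos: "cheb (cos \<phi>) n * sin \<phi> = sin (real n * \<phi>)"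
proof (induction "cos \<phi>" n rule: cheb.induct)
  case (3 n)
  have "sin (real (Suc (Suc n)) * \<phi>) = 2 * cos \<phi> * sin (real (Suc n) * \<phi>) - sin (real n * \<phi>)"
  proof -
    have *: "real (Suc (Suc n)) * \<phi> = real (Suc n) * \<phi> + \<phi>" "real n * \<phi> = real (Suc n) * \<phi> - \<phi>"
      by (simp_all add: algebra_simps)
    show ?thesis
      unfolding * sin_add sin_diff by (simp add: algebra_simps)
  qed
  with 3 show ?case
    by (simp add: algebra_simps)
qed auto

text \<open>Outside the open interval the values grow strictly in modulus from 0. Inside it, a zero
  would be a zero of \<open>sin (n * \<phi>)\<close>, making \<open>\<phi> / pi\<close>
  rational.\<close>

lemma cheb_nonzero:
  assumes "\<bar>\<tau>\<bar> \<ge> 1 \<or> arccos \<tau> / pi \<notin> \<rat>" "n > 0"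
  shows "cheb \<tau> n \<noteq> 0"
proof (cases "\<bar>\<tau>\<bar> \<ge> 1")
  case True
  then show ?thesis
    using cheb_abs_increasing[OF True, of "n - 1"] \<open>n > 0\<close> by auto
next
  case False
  define \<phi> where "\<phi> = arccos \<tau>"
  have \<tau>: "\<tau> = cos \<phi>"
    unfolding \<phi>_def using False by (intro cos_arccos_abs[symmetric]) auto
  have "sin (real n * \<phi>) \<noteq> 0"
  proof
    assume "sin (real n * \<phi>) = 0"
    then obtain k :: int where "real n * \<phi> = of_int k * pi"
      by (auto simp: sin_zero_iff_int2)
    then have "\<phi> / pi = of_int k / of_nat n"
      using \<open>n > 0\<close> by (simp add: field_simps)
    then have "\<phi> / pi \<in> \<rat>"
      by simp
    with assms False show False
      by (simp add: \<phi>_def)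
  qed
  then show ?thesis
    using cheb_cos[of \<phi> n] \<tau> by auto
qed

text \<open>The Casorati determinant of two solutions of the recurrence is independent of
  \<open>m\<close>, because the step matrix has determinant 1; at \<open>m = 0\<close> it is
  \<open>cheb \<tau> k\<close>.\<close>

lemma cheb_casorati: "cheb \<tau> (Suc m) * cheb \<tau> (m + k) - cheb \<tau> m * cheb \<tau> (Suc (m + k)) = cheb \<tau> k"
  by (induction m) (auto simp: algebra_simps)

text \<open>Cross-multiplying two ratios gives a Casorati determinant, which is the Chebyshev value
  at the difference of the indices.\<close>

lemma inj_cheb_ratio:
  assumes "\<And>n. n > 0 \<Longrightarrow> cheb \<tau> n \<noteq> 0"
  shows "inj (\<lambda>n. cheb \<tau> (Suc (Suc n)) / cheb \<tau> (Suc n))"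
proof (rule linorder_injI)
  fix m n :: nat
  assume "m < n"
  then obtain k where k: "n = m + k" "k > 0"
    using less_imp_add_positive by blast
  have "cheb \<tau> (Suc (Suc m)) * cheb \<tau> (Suc n) - cheb \<tau> (Suc m) * cheb \<tau> (Suc (Suc n)) \<noteq> 0"
    using cheb_casorati[of \<tau> "Suc m" k] assms[of k] k by (simp del: cheb.simps)
  then show "cheb \<tau> (Suc (Suc m)) / cheb \<tau> (Suc m) \<noteq> cheb \<tau> (Suc (Suc n)) / cheb \<tau> (Suc n)"
    using assms[of "Suc m"] assms[of "Suc n"] by (simp add: frac_eq_eq mult_ac del: cheb.simps)
qed

text \<open>By the law of cosines, this is the cosine of the angle between the radii at a common point, but it
  makes sense for circles that do not meet.\<close>

definition circles_cos :: "complex \<Rightarrow> real \<Rightarrow> complex \<Rightarrow> real \<Rightarrow> real" where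
  "circles_cos a1 r1 a2 r2 = (r1\<^sup>2 + r2\<^sup>2 - (dist a1 a2)\<^sup>2) / (2 * r1 * r2)"

section \<open>Inversions restricted to the line of centres\<close>

lemma circle_reflection_on_line:
  assumes "\<delta> \<noteq> 0"
  shows "circle_reflection a r (a + of_real t * \<delta>) = a + of_real (r\<^sup>2 / (t * (norm \<delta>)\<^sup>2)) * \<delta>"
proof (cases "t = 0")
  case False
  have "of_real ((norm \<delta>)\<^sup>2) = \<delta> * cnj \<delta>"
    by (metis complex_norm_square of_real_power)
  then show ?thesis
    using assms False by (simp add: circle_reflection_def field_simps)
qed (simp add: circle_reflection_def)

lemma reflection_orbit_exists:
  assumes r: "r1 > 0" "r2 > 0" and ne: "(a1, r1) \<noteq> (a2, r2)"
    and nz: "\<And>n. n > 0 \<Longrightarrow> cheb (circles_cos a1 r1 a2 r2) n \<noteq> 0"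
  shows "\<exists>x. inj x \<and> (\<forall>\<^sub>F n in sequentially. x (Suc n) = circle_reflection a2 r2 (circle_reflection a1 r1 (x n)))"
proof (cases "a1 = a2")
  case True
  \<comment> \<open>For concentric circles \<open>T\<close> is the scaling about the common centre
    by the squared ratio of the radii, which is not 1 since the circles differ. The orbit is a
    geometric progression.\<close>
  define q where "q = (r2 / r1)\<^sup>2"
  have q: "q > 0" "q \<noteq> 1"
    using r ne True by (auto simp: q_def power_divide power2_eq_iff)
  let ?x = "\<lambda>n. a1 + of_real (q ^ n) * 1"
  have "inj ?x"
    using q by (auto intro!: injI simp: power_inject_exp' simp flip: of_real_power)
  moreover have "?x (Suc n) = circle_reflection a2 r2 (circle_reflection a1 r1 (?x n))" for n
    unfolding True[symmetric] by (subst circle_reflection_on_line, simp)+ (use r q in \<open>simp add: q_def field_simps\<close>)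
  ultimately show ?thesis
    by (intro exI[of _ ?x]) simp
next
  case False
  define \<tau> where "\<tau> = circles_cos a1 r1 a2 r2"
  define \<delta> where "\<delta> = a2 - a1"
  define q where "q n = cheb \<tau> (Suc (Suc n)) / cheb \<tau> (Suc n)" for n
  \<comment> \<open>the orbit of infinity, in the coordinate \<open>a1 + t \<delta>\<close> on the line of centres\<close>
  define t where "t n = (r1\<^sup>2 - r1 * r2 * q n) / (norm \<delta>)\<^sup>2" for n
  let ?x = "\<lambda>n. a1 + of_real (t n) * \<delta>"
  have \<delta>: "\<delta> \<noteq> 0"
    using False by (simp add: \<delta>_def)
  have "inj q"
    unfolding q_def by (rule inj_cheb_ratio) (use nz in \<open>simp add: \<tau>_def\<close>)
  then have "inj t"
    using r \<delta> by (auto simp: t_def inj_def)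
  then have "inj ?x"
    using \<delta> by (auto simp: inj_def)
  moreover have "?x (Suc n) = circle_reflection a2 r2 (circle_reflection a1 r1 (?x n))" if "t n \<noteq> 0" for n
  proof -
    \<comment> \<open>Dividing the Chebyshev recursion by its middle term gives the Moebius step
      from \<open>q\<close> to \<open>2 * \<tau> - 1 / q\<close>. The rest of the block checks that
      \<open>T\<close> is its conjugate under the affine change from \<open>q\<close> to
      \<open>t\<close>.\<close>
    have qn: "q n \<noteq> 0" "q (Suc n) = 2 * \<tau> - 1 / q n"
      using nz[of "Suc n"] nz[of "Suc (Suc n)"] unfolding q_def \<tau>_def[symmetric] cheb.simps(3)[of \<tau> "Suc n"]
      by (simp_all add: diff_divide_distrib del: cheb.simps)
    have \<tau>: "2 * \<tau> * (r1 * r2) = r1\<^sup>2 + r2\<^sup>2 - (norm \<delta>)\<^sup>2"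
      using r by (simp add: \<tau>_def circles_cos_def \<delta>_def dist_norm norm_minus_commute)
    define D where "D = (norm \<delta>)\<^sup>2"
    have D: "D > 0" using \<delta> by (simp add: D_def)
    define s where "s = r1\<^sup>2 / (t n * D)"
    have tD: "t n * D = r1\<^sup>2 - r1 * r2 * q n"
      using D by (simp add: t_def D_def)
    have s: "s - 1 = r1 * r2 * q n / (t n * D)"
      using that D tD by (simp add: s_def field_simps)
    have "circle_reflection a1 r1 (?x n) = a1 + of_real s * \<delta>"
      by (simp only: circle_reflection_on_line[OF \<delta>] s_def D_def)
    \<comment> \<open>Moving the origin of the coordinate to \<open>a2 = a1 + \<delta>\<close> makes
      the second inversion a map of the same form as the first.\<close>
    also have "\<dots> = a2 + of_real (s - 1) * \<delta>"
      by (simp add: \<delta>_def algebra_simps)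
    finally have "circle_reflection a2 r2 (circle_reflection a1 r1 (?x n)) = a2 + of_real (r2\<^sup>2 / ((s - 1) * D)) * \<delta>"
      by (simp only: circle_reflection_on_line[OF \<delta>] D_def)
    also have "\<dots> = a1 + of_real (1 + r2\<^sup>2 / ((s - 1) * D)) * \<delta>"
      by (simp add: \<delta>_def algebra_simps)
    also have "1 + r2\<^sup>2 / ((s - 1) * D) = t (Suc n)"
    proof -
      have "r2\<^sup>2 / ((s - 1) * D) = r2 * t n / (r1 * q n)"
        using that D r qn(1) unfolding s by (simp add: field_simps power2_eq_square)
      also have "\<dots> = r2 * (t n * D) / (r1 * q n) / D"
        using D by simp
      also have "\<dots> = (r1 * r2 / q n - r2\<^sup>2) / D"
        using r qn(1) D unfolding tD by (simp add: field_simps power2_eq_square)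
      finally have "1 + r2\<^sup>2 / ((s - 1) * D) = (D + r1 * r2 / q n - r2\<^sup>2) / D"
        using D by (simp add: field_simps)
      moreover have "r1\<^sup>2 - r1 * r2 * q (Suc n) = D + r1 * r2 / q n - r2\<^sup>2"
        using \<tau> unfolding qn by (simp add: D_def algebra_simps)
      ultimately show ?thesis
        by (simp add: t_def D_def)
    qed
    finally show ?thesis ..
  qed
  \<comment> \<open>The value 0 belongs to the centre \<open>a1\<close>, which a true inversion
    sends to infinity; injectivity allows it at most once.\<close>
  moreover have "\<forall>\<^sub>F n in sequentially. t n \<noteq> 0"
    using finite_vimageI[OF _ \<open>inj t\<close>, of "{0}"]
    by (simp add: eventually_cofinite vimage_def flip: cofinite_eq_sequentially)
  ultimately show ?thesis
    by (intro exI[of _ ?x]) (auto elim: eventually_mono)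
qed

text \<open>The bound says that a nondegenerate triangle with sides \<open>r1\<close>,
  \<open>r2\<close> and \<open>d\<close> exists. Its apex on either side of the line of centres is a
  common point; \<open>X\<close> and \<open>Y\<close> are the coordinates of the apex along and
  across that line.\<close>

lemma two_intersections_if_circles_cos_less:
  assumes r: "r1 > 0" "r2 > 0" and cos: "\<bar>circles_cos a1 r1 a2 r2\<bar> < 1"
  shows "\<exists>p q. p \<noteq> q \<and> {p, q} \<subseteq> sphere a1 r1 \<inter> sphere a2 r2"
proof -
  define d where "d = dist a1 a2"
  have lt: "\<bar>r1\<^sup>2 + r2\<^sup>2 - d\<^sup>2\<bar> < 2 * r1 * r2"
    using cos r by (simp add: circles_cos_def d_def abs_mult)
  have "d \<noteq> 0"
  proof
    assume "d = 0"
    then have "r1\<^sup>2 + r2\<^sup>2 < 2 * r1 * r2" using lt by auto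
    then show False using zero_le_power2[of "r1 - r2"] by (simp add: power2_diff)
  qed
  then have d: "d > 0" by (simp add: d_def)
  define u where "u = (a2 - a1) / of_real d"
  have u: "norm u = 1" "a2 = a1 + of_real d * u"
    using d by (simp_all add: u_def norm_divide d_def dist_norm norm_minus_commute)
  define X where "X = (d\<^sup>2 + r1\<^sup>2 - r2\<^sup>2) / (2 * d)"
  have "(r1\<^sup>2 + r2\<^sup>2 - d\<^sup>2)\<^sup>2 < (2 * r1 * r2)\<^sup>2"
    using power_strict_mono[OF lt, of 2] by simp
  \<comment> \<open>Heron's formula: the numerator is 16 times the squared area of the triangle, so
    the right side is its squared height over the side \<open>d\<close>.\<close>
  moreover have "r1\<^sup>2 - X\<^sup>2 = ((2 * r1 * r2)\<^sup>2 - (r1\<^sup>2 + r2\<^sup>2 - d\<^sup>2)\<^sup>2) / (2 * d)\<^sup>2"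
    using d by (simp add: X_def power_divide field_simps) algebra
  ultimately have pos: "r1\<^sup>2 - X\<^sup>2 > 0"
    using d by simp
  define Y where "Y = sqrt (r1\<^sup>2 - X\<^sup>2)"
  have Y: "Y > 0" "Y\<^sup>2 = r1\<^sup>2 - X\<^sup>2"
    using pos by (simp_all add: Y_def)
  have XY: "(X - d)\<^sup>2 + Y\<^sup>2 = r2\<^sup>2"
  proof -
    have "2 * d * X = d\<^sup>2 + r1\<^sup>2 - r2\<^sup>2"
      using d by (simp add: X_def)
    then show ?thesis
      by (simp add: Y(2) power2_diff mult_ac)
  qed
  have on: "a1 + Complex X y * u \<in> sphere a1 r1 \<inter> sphere a2 r2" if "y\<^sup>2 = Y\<^sup>2" for y
  proof -
    have "norm (Complex X y) = r1"
      using that r Y by (simp add: complex_norm)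
    moreover have "norm (Complex (X - d) y) = r2"
      using that r XY by (simp add: complex_norm)
    moreover have "a1 + Complex X y * u - a2 = Complex (X - d) y * u"
      using u(2) by (simp add: complex_eq_iff algebra_simps)
    ultimately show ?thesis
      using u(1) by (simp add: dist_norm norm_mult norm_minus_commute[of a2])
  qed
  have "u \<noteq> 0" using u(1) by auto
  then have "a1 + Complex X Y * u \<noteq> a1 + Complex X (- Y) * u"
    using Y by simp
  with on[of Y] on[of "- Y"] show ?thesis
    by (intro exI[of _ "a1 + Complex X Y * u"] exI[of _ "a1 + Complex X (- Y) * u"]) auto
qed

text \<open>The law of cosines in the triangle \<open>a1\<close>, \<open>a2\<close>,
  \<open>p\<close>; in particular the angle is the same at every common point.\<close>

lemma circle_angle_eq_arccos:
  assumes "r1 > 0" "r2 > 0" "p \<in> sphere a1 r1 \<inter> sphere a2 r2"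
  shows "circle_angle a1 r1 a2 r2 p = arccos \<bar>circles_cos a1 r1 a2 r2\<bar>"
proof -
  have "(norm ((p - a1) - (p - a2)))\<^sup>2 = (norm (p - a1))\<^sup>2 + (norm (p - a2))\<^sup>2 - 2 * Re ((p - a1) * cnj (p - a2))"
    by (simp only: cmod_power2) (simp add: power2_eq_square algebra_simps)
  moreover have "norm (p - a1) = r1" "norm (p - a2) = r2" "norm ((p - a1) - (p - a2)) = dist a1 a2"
    using assms by (auto simp: dist_norm norm_minus_commute)
  ultimately have "Re ((p - a1) * cnj (p - a2)) = (r1\<^sup>2 + r2\<^sup>2 - (dist a1 a2)\<^sup>2) / 2"
    by simp
  then show ?thesis
    using assms unfolding circle_angle_def circles_cos_def by (simp only: abs_mult abs_divide) (simp add: mult_ac)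
qed

lemma cheb_circles_cos_nonzero:
  assumes r: "r1 > 0" "r2 > 0"
    and config: "circles_disjoint a1 r1 a2 r2 \<or> circles_tangent a1 r1 a2 r2 \<or>
      (\<exists>\<theta>. config5 a1 r1 a2 r2 \<theta> \<and> \<theta> / pi \<notin> \<rat>)"
    and "n > 0"
  shows "cheb (circles_cos a1 r1 a2 r2) n \<noteq> 0"
proof (rule cheb_nonzero[OF disjCI \<open>n > 0\<close>])
  let ?\<tau> = "circles_cos a1 r1 a2 r2"
  assume rat: "\<not> arccos ?\<tau> / pi \<notin> \<rat>"
  show "\<bar>?\<tau>\<bar> \<ge> 1"
  proof (rule ccontr)
    assume "\<not> \<bar>?\<tau>\<bar> \<ge> 1"
    then have lt: "\<bar>?\<tau>\<bar> < 1" by simp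
    from two_intersections_if_circles_cos_less[OF r lt]
    obtain p q where pq: "p \<noteq> q" "{p, q} \<subseteq> sphere a1 r1 \<inter> sphere a2 r2" by blast
    from config show False
    proof (elim disjE exE conjE)
      assume "circles_disjoint a1 r1 a2 r2"
      with pq show False by (auto simp: circles_disjoint_def)
    next
      assume "circles_tangent a1 r1 a2 r2"
      with pq show False by (metis card_1_singletonE circles_tangent_def insert_subset singletonD)
    next
      fix \<theta> assume \<theta>: "config5 a1 r1 a2 r2 \<theta>" "\<theta> / pi \<notin> \<rat>"
      then have "\<theta> = arccos \<bar>?\<tau>\<bar>"
        using pq circle_angle_eq_arccos[OF r, of p a1 a2] by (simp add: config5_def)
      \<comment> \<open>The absolute value can at most replace the angle by its supplement, which
        preserves rationality of the quotient by \<open>pi\<close>.\<close>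
      then have "\<theta> = arccos ?\<tau> \<or> \<theta> = pi - arccos ?\<tau>"
        using lt by (auto simp: abs_if arccos_minus)
      then have "\<theta> / pi = arccos ?\<tau> / pi \<or> \<theta> / pi = 1 - arccos ?\<tau> / pi"
        by (auto simp: diff_divide_distrib)
      with \<theta>(2) rat show False
        by auto
    qed
  qed
qed

section \<open>Rationality of the quotient\<close>

text \<open>The local factorization at \<open>b\<close> fills the hole of
  \<open>f z / (z - b) ^ n\<close>; the two descriptions of \<open>u\<close> are holomorphic on open
  sets that cover \<open>S\<close>.\<close>

lemma holomorphic_divide_zero:
  fixes f :: "complex \<Rightarrow> complex"
  assumes f: "f holomorphic_on S" and S: "open S" "connected S" and b: "b \<in> S" "f b = 0"
    and nz: "w \<in> S" "f w \<noteq> 0"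
  obtains n u where "u holomorphic_on S" "u b \<noteq> 0" "\<And>z. z \<in> S \<Longrightarrow> f z = (z - b) ^ n * u z"
proof -
  have "\<not> f constant_on S"
    using b nz by (metis constant_on_def)
  from holomorphic_factor_zero_nonconstant[OF f S b this]
  obtain h e n where n: "0 < n" "0 < e" "ball b e \<subseteq> S" "h holomorphic_on ball b e"
    "\<And>w. w \<in> ball b e \<Longrightarrow> f w = (w - b) ^ n * h w" "\<And>w. w \<in> ball b e \<Longrightarrow> h w \<noteq> 0"
    by metis
  define u where "u z = (if z = b then h b else f z / (z - b) ^ n)" for z
  have "u holomorphic_on ball b e"
    using n(4) by (rule holomorphic_transform) (simp add: u_def n(5))
  moreover have "u holomorphic_on S - {b}"
  proof (rule holomorphic_transform)
    show "(\<lambda>z. f z / (z - b) ^ n) holomorphic_on S - {b}"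
      by (intro holomorphic_intros holomorphic_on_subset[OF f]) auto
  qed (simp add: u_def)
  ultimately have "u holomorphic_on ball b e \<union> (S - {b})"
    using S by (intro holomorphic_on_Un open_delete) auto
  moreover have "ball b e \<union> (S - {b}) = S"
    using n(2,3) b by auto
  ultimately have "u holomorphic_on S"
    by simp
  then show thesis
    by (rule that[of _ n]) (use n b in \<open>auto simp: u_def\<close>)
qed

lemma holomorphic_factor_zeros_compact:
  fixes f :: "complex \<Rightarrow> complex"
  assumes f: "f holomorphic_on S" and S: "open S" "connected S" and K: "compact K" "K \<subseteq> S"
    and nz: "w \<in> S" "f w \<noteq> 0"
  shows "\<exists>bs u. set bs \<subseteq> K \<and> u holomorphic_on S \<and> (\<forall>z\<in>K. u z \<noteq> 0) \<and>
    (\<forall>z\<in>S. f z = (\<Prod>b\<leftarrow>bs. z - b) * u z)"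
proof -
  \<comment> \<open>Induction on the zero set, with \<open>f\<close> and \<open>w\<close> general:
    after a zero \<open>b\<close> is divided out, the cofactor takes over the role of
    \<open>f\<close>, and \<open>b\<close> is a point where it does not vanish.\<close>
  have "\<exists>bs u. set bs \<subseteq> K \<and> u holomorphic_on S \<and> (\<forall>z\<in>K. u z \<noteq> 0) \<and>
      (\<forall>z\<in>S. f z = (\<Prod>b\<leftarrow>bs. z - b) * u z)"
    if "finite Z" "Z = {z \<in> K. f z = 0}" "f holomorphic_on S" "w \<in> S" "f w \<noteq> 0" for Z f w
    using that
  proof (induction Z arbitrary: f w rule: finite_induct)
    case empty
    then show ?case
      by (intro exI[of _ "[]"] exI[of _ f]) auto
  next
    case (insert b Z)
    then have b: "b \<in> K" "b \<in> S" "f b = 0"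
      using K by auto
    from holomorphic_divide_zero[OF insert.prems(2) S b(2,3) insert.prems(3,4)]
    obtain n u where u: "u holomorphic_on S" "u b \<noteq> 0" "\<And>z. z \<in> S \<Longrightarrow> f z = (z - b) ^ n * u z"
      by metis
    have "n \<noteq> 0"
      using u(2) u(3)[OF b(2)] b(3) by (intro notI) simp
    have "{z \<in> K. u z = 0} = {z \<in> K. f z = 0} - {b}"
      using u(2,3) K \<open>n \<noteq> 0\<close> by auto
    then have "Z = {z \<in> K. u z = 0}"
      using insert.hyps(2) insert.prems(1) by auto
    from insert.IH[OF this u(1) b(2) u(2)]
    obtain bs v where bs: "set bs \<subseteq> K" "v holomorphic_on S" "\<forall>z\<in>K. v z \<noteq> 0"
      "\<forall>z\<in>S. u z = (\<Prod>b\<leftarrow>bs. z - b) * v z"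
      by blast
    show ?case
    proof (intro exI conjI)
      show "set (replicate n b @ bs) \<subseteq> K"
        using bs(1) b(1) by auto
      show "\<forall>z\<in>S. f z = (\<Prod>b\<leftarrow>replicate n b @ bs. z - b) * v z"
        using bs(4) u(3) by (simp add: prod_list_replicate)
    qed (use bs in auto)
  qed
  moreover have "finite {z \<in> K. f z = 0}"
  proof (cases "f constant_on S")
    case True
    then have "{z \<in> K. f z = 0} = {}"
      using nz K by (auto simp: constant_on_def)
    then show ?thesis by (metis finite.emptyI)
  next
    case False
    then show ?thesis
      using holomorphic_compact_finite_zeros f S K by blast
  qed
  ultimately show ?thesis
    using f nz by blast
qed

text \<open>The maximum principle for both \<open>u / v\<close> and \<open>v / u\<close> gives
  modulus 1 throughout the disc. The modulus is then maximal at the centre, so the quotient is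
  constant there, and the identity theorem carries this to \<open>S\<close>.\<close>

lemma nonvanishing_proportional_if_norm_eq_on_sphere:
  assumes u: "u holomorphic_on S" "\<And>z. z \<in> cball a r \<Longrightarrow> u z \<noteq> 0"
    and v: "v holomorphic_on S" "\<And>z. z \<in> cball a r \<Longrightarrow> v z \<noteq> 0"
    and S: "open S" "connected S" "cball a r \<subseteq> S" and r: "r > 0"
    and eq: "\<And>z. z \<in> sphere a r \<Longrightarrow> norm (u z) = norm (v z)"
  shows "\<exists>c. c \<noteq> 0 \<and> (\<forall>z\<in>S. u z = c * v z)"
proof -
  have le: "norm (h z / k z) \<le> 1"
    if "h holomorphic_on S" "k holomorphic_on S" "\<And>z. z \<in> cball a r \<Longrightarrow> k z \<noteq> 0"
      "\<And>z. z \<in> sphere a r \<Longrightarrow> norm (h z) = norm (k z)" "z \<in> ball a r" for h k z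
  proof (rule maximum_modulus_frontier[of "\<lambda>z. h z / k z" "ball a r"])
    have "(\<lambda>z. h z / k z) holomorphic_on cball a r"
      using that S by (intro holomorphic_intros) (auto intro: holomorphic_on_subset)
    then show "(\<lambda>z. h z / k z) holomorphic_on interior (ball a r)"
      "continuous_on (closure (ball a r)) (\<lambda>z. h z / k z)"
      using r by (auto intro: holomorphic_on_subset holomorphic_on_imp_continuous_on)
    show "norm (h z / k z) \<le> 1" if "z \<in> frontier (ball a r)" for z
      using that r \<open>\<And>z. z \<in> sphere a r \<Longrightarrow> norm (h z) = norm (k z)\<close>[of z]
      by (simp add: norm_divide frontier_ball)
  qed (use that in auto)
  let ?q = "\<lambda>z. u z / v z"
  have one: "norm (?q z) = 1" if "z \<in> ball a r" for z
  proof -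
    have "norm (u z / v z) \<le> 1" "norm (v z / u z) \<le> 1"
      using le[OF u(1) v eq that] le[OF v(1) u eq[symmetric] that] by auto
    moreover have "u z \<noteq> 0" "v z \<noteq> 0"
      using that u v by auto
    ultimately show ?thesis
      by (simp add: norm_divide divide_simps)
  qed
  have "?q constant_on ball a r"
  proof (rule maximum_modulus_principle[where \<xi> = a and U = "ball a r"])
    have "ball a r \<subseteq> S"
      using S(3) ball_subset_cball by blast
    then show "?q holomorphic_on ball a r"
      using u v by (intro holomorphic_intros) (auto intro: holomorphic_on_subset)
  qed (use r one in auto)
  then obtain c where c: "\<And>z. z \<in> ball a r \<Longrightarrow> ?q z = c"
    by (auto simp: constant_on_def)
  have "c \<noteq> 0"
    using one[of a] c[of a] r by auto
  moreover have "u z = c * v z" if "z \<in> S" for z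
  proof (rule analytic_continuation_open[where s = "ball a r" and s' = S and f = u and g = "\<lambda>z. c * v z"])
    show "u z = c * v z" if "z \<in> ball a r" for z
      using c[OF that] v(2)[of z] that by (auto simp: field_simps)
  qed (use S r u v that in \<open>auto intro!: holomorphic_intros\<close>)
  ultimately show ?thesis
    by blast
qed

text \<open>This is the denominator of the Blaschke factor for \<open>b\<close>. On the circle
  \<open>r\<^sup>2 = cnj (z - a) * (z - a)\<close>, which turns the numerator of the fraction into
  \<open>cnj (z - b) * (z - a)\<close>.\<close>

lemma reflected_factor_norm:
  assumes "z \<in> sphere a r" "r > 0"
  shows "norm ((of_real (r\<^sup>2) - cnj (b - a) * (z - a)) / of_real r) = norm (z - b)"
proof -
  have n: "norm (z - a) = r"
    using assms by (simp add: dist_norm norm_minus_commute)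
  then have "of_real (r\<^sup>2) = cnj (z - a) * (z - a)"
    by (metis complex_norm_square mult.commute of_real_power)
  then have "of_real (r\<^sup>2) - cnj (b - a) * (z - a) = cnj (z - b) * (z - a)"
    by (simp add: algebra_simps)
  then show ?thesis
    using n assms by (simp add: norm_divide norm_mult del: complex_cnj_diff)
qed

text \<open>A zero could only lie at the mirror image of \<open>b\<close>, outside the closed disc:
  inside, the subtracted product has norm below \<open>r\<^sup>2\<close>.\<close>

lemma reflected_factor_nonzero:
  assumes "b \<in> ball a r" "z \<in> cball a r"
  shows "of_real (r\<^sup>2) - cnj (b - a) * (z - a) \<noteq> 0"
proof
  assume "of_real (r\<^sup>2) - cnj (b - a) * (z - a) = 0"
  then have "norm (of_real (r\<^sup>2) :: complex) = norm (cnj (b - a) * (z - a))"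
    by simp
  then have "r\<^sup>2 = norm (b - a) * norm (z - a)"
    by (simp only: norm_mult complex_mod_cnj norm_of_real) simp
  moreover have "norm (b - a) < r" "norm (z - a) \<le> r"
    using assms by (auto simp: dist_norm norm_minus_commute)
  moreover have "norm (b - a) * norm (z - a) \<le> norm (b - a) * r"
    using \<open>norm (z - a) \<le> r\<close> by (intro mult_left_mono) auto
  moreover have "norm (b - a) * r < r * r"
    using \<open>norm (b - a) < r\<close> by (intro mult_strict_right_mono) (auto intro: le_less_trans[OF norm_ge_zero])
  ultimately show False
    by (simp add: power2_eq_square)
qed

section \<open>Removing listed zeros one at a time\<close>

lemma prod_list_map_remove1:
  fixes h :: "'a \<Rightarrow> 'b::comm_monoid_mult"
  shows "b \<in> set bs \<Longrightarrow> (\<Prod>c\<leftarrow>bs. h c) = h b * (\<Prod>c\<leftarrow>remove1 b bs. h c)"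
  by (induction bs) (auto simp: mult_ac)

lemma length_remove1_less: "b \<in> set bs \<Longrightarrow> length (remove1 b bs) < length bs"
  by (induction bs) auto

lemma prod_list_diff_eq_0_iff: "(\<Prod>c\<leftarrow>bs. z - c) = 0 \<longleftrightarrow> z \<in> set bs" for z :: complex
  by (induction bs) auto

lemma continuous_on_prod_list_diff: "continuous_on A (\<lambda>z. \<Prod>c\<leftarrow>bs. z - c)" for A :: "complex set"
  by (induction bs) (auto intro!: continuous_intros)

text \<open>One Blaschke exchange: the factor \<open>z - b\<close> is replaced by its mirror factor
  \<open>L\<close>, zero-free on the closed disc and thus absorbed into \<open>u'\<close>. The last
  conclusion keeps track of the change as a polynomial identity.\<close>

lemma reflect_interior_zero:
  assumes S: "cball a r \<subseteq> S" and r: "r > 0" and u: "u holomorphic_on S" "\<And>z. z \<in> cball a r \<Longrightarrow> u z \<noteq> 0"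
    and b: "b \<in> set bs" "b \<in> ball a r"
  obtains u' L where "u' holomorphic_on S" "\<And>z. z \<in> cball a r \<Longrightarrow> u' z \<noteq> 0" "L \<noteq> 0"
    "\<And>z. z \<in> sphere a r \<Longrightarrow> norm ((\<Prod>c\<leftarrow>remove1 b bs. z - c) * u' z) = norm ((\<Prod>c\<leftarrow>bs. z - c) * u z)"
    "\<And>z. (\<Prod>c\<leftarrow>bs. z - c) * u z * poly L z = (\<Prod>c\<leftarrow>remove1 b bs. z - c) * u' z * poly [:- b, 1:] z"
proof -
  define L where "L = [:(of_real (r\<^sup>2) + cnj (b - a) * a) / of_real r, - cnj (b - a) / of_real r:]"
  have L: "poly L z = (of_real (r\<^sup>2) - cnj (b - a) * (z - a)) / of_real r" for z
    using r by (simp add: L_def field_simps)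
  have split: "(\<Prod>c\<leftarrow>bs. z - c) = (z - b) * (\<Prod>c\<leftarrow>remove1 b bs. z - c)" for z
    using b(1) by (rule prod_list_map_remove1)
  define u' where "u' z = u z * poly L z" for z
  have nz: "poly L z \<noteq> 0" if "z \<in> cball a r" for z
    using reflected_factor_nonzero[OF b(2) that] r by (simp add: L)
  show thesis
  proof (rule that[of u' L])
    show "u' holomorphic_on S"
      unfolding u'_def by (intro holomorphic_intros u poly_holomorphic_on)
    show "u' z \<noteq> 0" if "z \<in> cball a r" for z
      using u(2)[OF that] nz[OF that] by (simp add: u'_def)
    show "L \<noteq> 0"
      using nz[of a] r by auto
    show "norm ((\<Prod>c\<leftarrow>remove1 b bs. z - c) * u' z) = norm ((\<Prod>c\<leftarrow>bs. z - c) * u z)" if "z \<in> sphere a r" for z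
      unfolding split u'_def norm_mult L reflected_factor_norm[OF that r] by simp
    show "(\<Prod>c\<leftarrow>bs. z - c) * u z * poly L z = (\<Prod>c\<leftarrow>remove1 b bs. z - c) * u' z * poly [:- b, 1:] z" for z
      unfolding split u'_def by simp
  qed
qed

text \<open>Induction on the number of listed zeros. Interior zeros of either function are exchanged
  for mirror factors, zeros on the circle are common to both and cancel, and with none left the
  functions are proportional.\<close>

lemma rational_quotient_if_factored:
  assumes S: "open S" "connected S" "cball a r \<subseteq> S" and r: "r > 0"
    and "u holomorphic_on S" "\<And>z. z \<in> cball a r \<Longrightarrow> u z \<noteq> 0"
    and "v holomorphic_on S" "\<And>z. z \<in> cball a r \<Longrightarrow> v z \<noteq> 0"
    and "set bs \<subseteq> cball a r" "set cs \<subseteq> cball a r"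
    and "\<And>z. z \<in> sphere a r \<Longrightarrow> norm ((\<Prod>b\<leftarrow>bs. z - b) * u z) = norm ((\<Prod>c\<leftarrow>cs. z - c) * v z)"
  shows "\<exists>P Q. P \<noteq> 0 \<and> Q \<noteq> 0 \<and>
    (\<forall>z\<in>S. (\<Prod>b\<leftarrow>bs. z - b) * u z * poly Q z = (\<Prod>c\<leftarrow>cs. z - c) * v z * poly P z)"
  using assms(5-)
proof (induction "length bs + length cs" arbitrary: bs cs u v rule: less_induct)
  case less
  note u = less.prems(1,2) and v = less.prems(3,4) and sub = less.prems(5,6) and eq = less.prems(7)
  have bdry: "b \<in> ball a r \<or> b \<in> sphere a r" if "b \<in> set bs \<union> set cs" for b
  proof -
    have "dist a b \<le> r"
      using that sub by (metis UnE mem_cball subsetD)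
    then show ?thesis
      by (simp add: le_less)
  qed
  consider (f) b where "b \<in> set bs" "b \<in> ball a r" | (g) c where "c \<in> set cs" "c \<in> ball a r"
    | (bd) b where "b \<in> set bs \<union> set cs" "b \<in> sphere a r" | (empty) "bs = []" "cs = []"
    using bdry by (metis UnI1 UnI2 UnE list.set_intros(1) neq_Nil_conv)
  then show ?case
  proof cases
    case f
    from reflect_interior_zero[OF S(3) r u f]
    obtain u' L where u': "u' holomorphic_on S" "\<And>z. z \<in> cball a r \<Longrightarrow> u' z \<noteq> 0" "L \<noteq> 0"
      "\<And>z. z \<in> sphere a r \<Longrightarrow> norm ((\<Prod>c\<leftarrow>remove1 b bs. z - c) * u' z) = norm ((\<Prod>c\<leftarrow>bs. z - c) * u z)"
      "\<And>z. (\<Prod>c\<leftarrow>bs. z - c) * u z * poly L z = (\<Prod>c\<leftarrow>remove1 b bs. z - c) * u' z * poly [:- b, 1:] z"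
      by blast
    have len: "length (remove1 b bs) + length cs < length bs + length cs"
      using length_remove1_less[OF f(1)] by simp
    have set: "set (remove1 b bs) \<subseteq> cball a r"
      using sub(1) set_remove1_subset[of b bs] by (rule subset_trans[rotated])
    have eq': "norm ((\<Prod>c\<leftarrow>remove1 b bs. z - c) * u' z) = norm ((\<Prod>c\<leftarrow>cs. z - c) * v z)"
      if "z \<in> sphere a r" for z
      using u'(4)[OF that] eq[OF that] by simp
    have "\<exists>P Q. P \<noteq> 0 \<and> Q \<noteq> 0 \<and>
        (\<forall>z\<in>S. (\<Prod>c\<leftarrow>remove1 b bs. z - c) * u' z * poly Q z = (\<Prod>c\<leftarrow>cs. z - c) * v z * poly P z)"
      by (rule less.hyps) (fact len u'(1,2) v set sub(2) eq')+
    then obtain P Q where PQ: "P \<noteq> 0" "Q \<noteq> 0" 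
      "\<And>z. z \<in> S \<Longrightarrow> (\<Prod>c\<leftarrow>remove1 b bs. z - c) * u' z * poly Q z = (\<Prod>c\<leftarrow>cs. z - c) * v z * poly P z"
      by blast
    have "(\<Prod>c\<leftarrow>bs. z - c) * u z * poly (L * Q) z = (\<Prod>c\<leftarrow>cs. z - c) * v z * poly ([:- b, 1:] * P) z"
      if "z \<in> S" for z
    proof -
      have "(\<Prod>c\<leftarrow>bs. z - c) * u z * poly (L * Q) z
          = ((\<Prod>c\<leftarrow>bs. z - c) * u z * poly L z) * poly Q z"
        by simp
      also have "\<dots> = ((\<Prod>c\<leftarrow>remove1 b bs. z - c) * u' z * poly Q z) * poly [:- b, 1:] z"
        unfolding u'(5) by (simp only: mult_ac)
      also have "\<dots> = (\<Prod>c\<leftarrow>cs. z - c) * v z * poly ([:- b, 1:] * P) z"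
        unfolding PQ(3)[OF that] poly_mult by (simp only: mult_ac)
      finally show ?thesis .
    qed
    moreover have "L * Q \<noteq> 0" "[:- b, 1:] * P \<noteq> 0"
      using PQ(1,2) u'(3) by (metis mult_eq_0_iff pCons_eq_0_iff zero_neq_one)+
    ultimately show ?thesis
      by blast
  next
    case g
    from reflect_interior_zero[OF S(3) r v g]
    obtain v' L where v': "v' holomorphic_on S" "\<And>z. z \<in> cball a r \<Longrightarrow> v' z \<noteq> 0" "L \<noteq> 0"
      "\<And>z. z \<in> sphere a r \<Longrightarrow> norm ((\<Prod>b\<leftarrow>remove1 c cs. z - b) * v' z) = norm ((\<Prod>c\<leftarrow>cs. z - c) * v z)"
      "\<And>z. (\<Prod>c\<leftarrow>cs. z - c) * v z * poly L z = (\<Prod>b\<leftarrow>remove1 c cs. z - b) * v' z * poly [:- c, 1:] z"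
      by blast
    have len: "length bs + length (remove1 c cs) < length bs + length cs"
      using length_remove1_less[OF g(1)] by simp
    have set: "set (remove1 c cs) \<subseteq> cball a r"
      using sub(2) set_remove1_subset[of c cs] by (rule subset_trans[rotated])
    have eq': "norm ((\<Prod>b\<leftarrow>bs. z - b) * u z) = norm ((\<Prod>b\<leftarrow>remove1 c cs. z - b) * v' z)"
      if "z \<in> sphere a r" for z
      using v'(4)[OF that] eq[OF that] by simp
    have "\<exists>P Q. P \<noteq> 0 \<and> Q \<noteq> 0 \<and>
        (\<forall>z\<in>S. (\<Prod>b\<leftarrow>bs. z - b) * u z * poly Q z = (\<Prod>b\<leftarrow>remove1 c cs. z - b) * v' z * poly P z)"
      by (rule less.hyps) (fact len u v'(1,2) set sub(1) eq')+
    then obtain P Q where PQ: "P \<noteq> 0" "Q \<noteq> 0" 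
      "\<And>z. z \<in> S \<Longrightarrow> (\<Prod>b\<leftarrow>bs. z - b) * u z * poly Q z = (\<Prod>b\<leftarrow>remove1 c cs. z - b) * v' z * poly P z"
      by blast
    have "(\<Prod>b\<leftarrow>bs. z - b) * u z * poly ([:- c, 1:] * Q) z = (\<Prod>c\<leftarrow>cs. z - c) * v z * poly (L * P) z"
      if "z \<in> S" for z
    proof -
      have "(\<Prod>b\<leftarrow>bs. z - b) * u z * poly ([:- c, 1:] * Q) z
          = ((\<Prod>b\<leftarrow>bs. z - b) * u z * poly Q z) * poly [:- c, 1:] z"
        unfolding poly_mult by (simp only: mult_ac)
      also have "\<dots> = ((\<Prod>b\<leftarrow>remove1 c cs. z - b) * v' z * poly [:- c, 1:] z) * poly P z"
        unfolding PQ(3)[OF that] by (simp only: mult_ac)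
      also have "\<dots> = (\<Prod>c\<leftarrow>cs. z - c) * v z * poly (L * P) z"
        unfolding v'(5)[symmetric] poly_mult by (simp only: mult_ac)
      finally show ?thesis .
    qed
    moreover have "L * P \<noteq> 0" "[:- c, 1:] * Q \<noteq> 0"
      using PQ(1,2) v'(3) by (metis mult_eq_0_iff pCons_eq_0_iff zero_neq_one)+
    ultimately show ?thesis
      by blast
  next
    case bd
    have "b \<in> cball a r"
      using bd by auto
    \<comment> \<open>Equal norms at \<open>b\<close> make both functions vanish there or neither,
      and \<open>u\<close> and \<open>v\<close> do not vanish.\<close>
    then have "b \<in> set bs \<longleftrightarrow> b \<in> set cs"
      using eq[OF bd(2)] u(2)[of b] v(2)[of b] prod_list_diff_eq_0_iff[of b bs] prod_list_diff_eq_0_iff[of b cs]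
      by (metis mult_eq_0_iff norm_eq_zero)
    with bd have b: "b \<in> set bs" "b \<in> set cs"
      by auto
    have split: "(\<Prod>c\<leftarrow>bs. z - c) = (z - b) * (\<Prod>c\<leftarrow>remove1 b bs. z - c)"
      "(\<Prod>c\<leftarrow>cs. z - c) = (z - b) * (\<Prod>c\<leftarrow>remove1 b cs. z - c)" for z
      using b by (auto intro: prod_list_map_remove1)
    have cont: "continuous_on (sphere a r) (\<lambda>z. norm ((\<Prod>c\<leftarrow>ds. z - c) * w z))"
      if "w holomorphic_on S" for ds w
    proof -
      have "w holomorphic_on sphere a r"
        using that by (rule holomorphic_on_subset) (use S(3) sphere_cball in blast)
      then show ?thesis
        by (intro continuous_on_norm continuous_on_mult holomorphic_on_imp_continuous_on continuous_on_prod_list_diff)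
    qed
    \<comment> \<open>Cancelling \<open>z - b\<close> proves this away from \<open>b\<close>;
      continuity supplies the point \<open>b\<close>.\<close>
    have eq': "norm ((\<Prod>c\<leftarrow>remove1 b bs. z - c) * u z) = norm ((\<Prod>c\<leftarrow>remove1 b cs. z - c) * v z)"
      if "z \<in> sphere a r" for z
      using r _ cont[OF u(1)] cont[OF v(1)] _ that
    proof (rule continuous_eq_on_sphere_if_cofinite[where F = "{b}"])
      show "norm ((\<Prod>c\<leftarrow>remove1 b bs. z - c) * u z) = norm ((\<Prod>c\<leftarrow>remove1 b cs. z - c) * v z)"
        if "z \<in> sphere a r - {b}" for z
        using eq[of z] that unfolding split by (simp add: norm_mult)
    qed simp
    have len: "length (remove1 b bs) + length (remove1 b cs) < length bs + length cs"
      using b by (intro add_strict_mono length_remove1_less)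
    have set: "set (remove1 b bs) \<subseteq> cball a r" "set (remove1 b cs) \<subseteq> cball a r"
      using sub set_remove1_subset by (metis subset_trans)+
    have "\<exists>P Q. P \<noteq> 0 \<and> Q \<noteq> 0 \<and>
        (\<forall>z\<in>S. (\<Prod>c\<leftarrow>remove1 b bs. z - c) * u z * poly Q z = (\<Prod>c\<leftarrow>remove1 b cs. z - c) * v z * poly P z)"
      by (rule less.hyps) (fact len u v set eq')+
    then obtain P Q where PQ: "P \<noteq> 0" "Q \<noteq> 0" 
      "\<And>z. z \<in> S \<Longrightarrow> (\<Prod>c\<leftarrow>remove1 b bs. z - c) * u z * poly Q z = (\<Prod>c\<leftarrow>remove1 b cs. z - c) * v z * poly P z"
      by blast
    have "(\<Prod>c\<leftarrow>bs. z - c) * u z * poly Q z = (\<Prod>c\<leftarrow>cs. z - c) * v z * poly P z" if "z \<in> S" for z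
      using arg_cong[OF PQ(3)[OF that], of "\<lambda>t. (z - b) * t"] unfolding split by (simp only: mult.assoc)
    with PQ(1,2) show ?thesis
      by blast
  next
    case empty
    then obtain c where "c \<noteq> 0" "\<forall>z\<in>S. u z = c * v z"
      using nonvanishing_proportional_if_norm_eq_on_sphere[OF u v S r] eq by auto
    with empty show ?thesis
      by (intro exI[of _ "[:c:]"] exI[of _ 1]) auto
  qed
qed

lemma rational_quotient_if_norm_eq_on_sphere:
  assumes f: "f holomorphic_on S" "w \<in> S" "f w \<noteq> 0" and g: "g holomorphic_on S" "w' \<in> S" "g w' \<noteq> 0"
    and S: "open S" "connected S" "cball a r \<subseteq> S" and r: "r > 0"
    and eq: "\<And>z. z \<in> sphere a r \<Longrightarrow> norm (f z) = norm (g z)"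
  shows "\<exists>P Q. P \<noteq> 0 \<and> Q \<noteq> 0 \<and> (\<forall>z\<in>S. f z * poly Q z = g z * poly P z)"
proof -
  obtain bs u where u: "set bs \<subseteq> cball a r" "u holomorphic_on S" "\<forall>z\<in>cball a r. u z \<noteq> 0"
    "\<forall>z\<in>S. f z = (\<Prod>b\<leftarrow>bs. z - b) * u z"
    using holomorphic_factor_zeros_compact[OF f(1) S(1,2) compact_cball S(3) f(2,3)] by blast
  obtain cs v where v: "set cs \<subseteq> cball a r" "v holomorphic_on S" "\<forall>z\<in>cball a r. v z \<noteq> 0"
    "\<forall>z\<in>S. g z = (\<Prod>c\<leftarrow>cs. z - c) * v z"
    using holomorphic_factor_zeros_compact[OF g(1) S(1,2) compact_cball S(3) g(2,3)] by blast
  have "sphere a r \<subseteq> S"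
    using S(3) by auto
  then have "norm ((\<Prod>b\<leftarrow>bs. z - b) * u z) = norm ((\<Prod>c\<leftarrow>cs. z - c) * v z)" if "z \<in> sphere a r" for z
    using eq[OF that] u(4) v(4) that by auto
  from rational_quotient_if_factored[OF S r u(2) _ v(2) _ u(1) v(1) this] u v show ?thesis
    by auto
qed

section \<open>Rigidity\<close>

text \<open>At points of the circle where \<open>f\<close>, hence also \<open>g\<close>, is nonzero,
  the equal norms cancel in \<open>PQ\<close>. The remaining points are finitely many by
  compactness.\<close>

lemma poly_norm_eq_on_sphere_if_quotient:
  assumes f: "f holomorphic_on S" "w \<in> S" "f w \<noteq> 0" and S: "open S" "connected S" "sphere a r \<subseteq> S" and r: "r > 0"
    and eq: "\<And>z. z \<in> sphere a r \<Longrightarrow> norm (f z) = norm (g z)"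
    and PQ: "\<And>z. z \<in> S \<Longrightarrow> f z * poly Q z = g z * poly P z"
    and z: "z \<in> sphere a r"
  shows "norm (poly P z) = norm (poly Q z)"
proof (rule continuous_eq_on_sphere_if_cofinite[OF r _ _ _ _ z])
  show "finite {z \<in> sphere a r. f z = 0}"
  proof (cases "f constant_on S")
    case True
    then have "{z \<in> sphere a r. f z = 0} = {}"
      using f(2,3) S(3) by (fastforce simp: constant_on_def)
    then show ?thesis
      by (metis finite.emptyI)
  next
    case False
    then show ?thesis
      using holomorphic_compact_finite_zeros[OF f(1) S(1,2) compact_sphere S(3)] by blast
  qed
  show "norm (poly P z) = norm (poly Q z)" if "z \<in> sphere a r - {z \<in> sphere a r. f z = 0}" for z
  proof -
    have "norm (f z) * norm (poly Q z) = norm (g z) * norm (poly P z)"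
      using PQ[of z] that S(3) by (metis Diff_iff norm_mult subsetD)
    with eq[of z] that show ?thesis
      by auto
  qed
qed (intro continuous_intros)+

lemma eq_if_poly_multiples_eq:
  fixes f h :: "complex \<Rightarrow> complex"
  assumes "f holomorphic_on S" "h holomorphic_on S" "open S" "Q \<noteq> 0"
    and eq: "\<And>z. z \<in> S \<Longrightarrow> f z * poly Q z = h z * poly Q z" and z: "z \<in> S"
  shows "f z = h z"
proof -
  have "\<forall>\<^sub>F w in at z. w \<in> S"
    using assms z by (simp add: eventually_at_in_open')
  moreover have "\<forall>\<^sub>F w in at z. w \<notin> {w. poly Q w = 0}"
    using poly_roots_finite[OF \<open>Q \<noteq> 0\<close>] by (metis islimpt_iff_eventually islimpt_finite)
  ultimately have "\<forall>\<^sub>F w in at z. f w = h w"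
    by eventually_elim (use eq in auto)
  moreover have "f \<midarrow>z\<rightarrow> f z" "h \<midarrow>z\<rightarrow> h z"
    using assms z unfolding isCont_def[symmetric]
    by (metis continuous_on_eq_continuous_at holomorphic_on_imp_continuous_on)+
  ultimately show ?thesis
    by (metis LIM_unique tendsto_cong)
qed

text \<open>The closed disc is the convex hull of its boundary circle, and the unit disc is
  convex.\<close>

lemma circle_in_disc_cball:
  assumes "circle_in_disc a r"
  shows "r > 0" "cball a r \<subseteq> ball 0 1"
proof -
  show r: "r > 0"
    using assms by (simp add: circle_in_disc_def)
  have "convex hull (sphere a r) \<subseteq> ball 0 1"
    using assms by (intro hull_minimal) (auto simp: circle_in_disc_def)
  then show "cball a r \<subseteq> ball 0 1"
    using Krein_Milman_frontier[OF convex_cball compact_cball, of a r] by simp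
qed

lemma unimodular_multiple_if_norm_eq_on_circles:
  assumes f: "f holomorphic_on ball 0 1" and g: "g holomorphic_on ball 0 1"
    and circ: "circle_in_disc a1 r1" "circle_in_disc a2 r2" "(a1, r1) \<noteq> (a2, r2)"
    and eq: "\<forall>z \<in> sphere a1 r1 \<union> sphere a2 r2. norm (f z) = norm (g z)"
    and config: "circles_disjoint a1 r1 a2 r2 \<or> circles_tangent a1 r1 a2 r2 \<or>
      (\<exists>\<theta>. config5 a1 r1 a2 r2 \<theta> \<and> \<theta> / pi \<notin> \<rat>)"
  shows "unimodular_multiple f g"
proof -
  note r = circle_in_disc_cball(1)[OF circ(1)] circle_in_disc_cball(1)[OF circ(2)]
  have sub: "sphere a1 r1 \<subseteq> ball 0 1" "sphere a2 r2 \<subseteq> ball 0 1"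
    using circ by (auto simp: circle_in_disc_def)
  \<comment> \<open>For the degenerate case: if one function vanishes identically, the other
    vanishes on the first circle and hence everywhere.\<close>
  have zero: "h z = 0"
    if h: "h holomorphic_on ball 0 1" "\<And>z. z \<in> sphere a1 r1 \<Longrightarrow> h z = 0" "z \<in> ball 0 1" for h :: "complex \<Rightarrow> complex" and z
  proof -
    have p: "a1 + of_real r1 \<in> sphere a1 r1"
      using r by (simp add: dist_norm)
    then have "a1 + of_real r1 \<in> ball 0 1"
      using sub by blast
    from analytic_continuation[OF h(1) open_ball connected_ball sub(1) this sphere_islimpt[OF r(1) p] h(2,3)]
    show ?thesis .
  qed
  show ?thesis
  proof (cases "(\<forall>z\<in>ball 0 1. f z = 0) \<or> (\<forall>z\<in>ball 0 1. g z = 0)")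
    case True
    then have "(\<forall>z\<in>sphere a1 r1. f z = 0) \<and> (\<forall>z\<in>sphere a1 r1. g z = 0)"
      using eq sub(1) by (metis UnI1 norm_eq_zero subsetD)
    then have "\<forall>z\<in>ball 0 1. f z = 1 * g z"
      using zero[OF f] zero[OF g] by simp
    then show ?thesis
      unfolding unimodular_multiple_def by (metis norm_one)
  next
    case False
    then obtain w w' where w: "w \<in> ball 0 1" "f w \<noteq> 0" "w' \<in> ball 0 1" "g w' \<noteq> 0"
      by blast
    have "\<exists>P Q. P \<noteq> 0 \<and> Q \<noteq> 0 \<and> (\<forall>z\<in>ball 0 1. f z * poly Q z = g z * poly P z)"
      using f w(1,2) g w(3,4) open_ball connected_ball circle_in_disc_cball(2)[OF circ(1)] r(1)
      by (rule rational_quotient_if_norm_eq_on_sphere) (use eq in simp)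
    then obtain P Q where PQ: "P \<noteq> 0" "Q \<noteq> 0" "\<forall>z\<in>ball 0 1. f z * poly Q z = g z * poly P z"
      by blast
    have norm_eq: "norm (poly P z) = norm (poly Q z)"
      if "sphere a r \<subseteq> sphere a1 r1 \<union> sphere a2 r2" "r > 0" "z \<in> sphere a r" for a r z
    proof (rule poly_norm_eq_on_sphere_if_quotient[OF f w(1,2) open_ball connected_ball _ that(2) _ _ that(3)])
      show "sphere a r \<subseteq> ball 0 1"
        using that(1) sub by blast
      show "norm (f z) = norm (g z)" if "z \<in> sphere a r" for z
        using eq that \<open>sphere a r \<subseteq> sphere a1 r1 \<union> sphere a2 r2\<close> by blast
    qed (use PQ in auto)
    obtain x where x: "inj x"
      "\<forall>\<^sub>F n in sequentially. x (Suc n) = circle_reflection a2 r2 (circle_reflection a1 r1 (x n))"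
      using reflection_orbit_exists[OF r circ(3) cheb_circles_cos_nonzero[OF r config]] by blast
    have "\<exists>c. norm c = 1 \<and> P = smult c Q"
      using r PQ(1,2) norm_eq[OF Un_upper1 r(1)] norm_eq[OF Un_upper2 r(2)] x
      by (rule poly_unimodular_multiple_if_orbit)
    then obtain c where c: "norm c = 1" "P = smult c Q"
      by blast
    have "f z = c * g z" if "z \<in> ball 0 1" for z
    proof (rule eq_if_poly_multiples_eq[OF f _ open_ball PQ(2) _ that])
      show "(\<lambda>z. c * g z) holomorphic_on ball 0 1"
        by (intro holomorphic_intros g)
      show "f z * poly Q z = c * g z * poly Q z" if "z \<in> ball 0 1" for z
        using PQ(3) that c(2) by (auto simp: mult_ac)
    qed
    with c(1) show ?thesis
      by (auto simp: unimodular_multiple_def)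
  qed
qed

section \<open>Circles crossing at a rational angle\<close>

text \<open>The Cayley transform is unimodular on the real axis; with \<open>X / Y\<close> as its
  argument and denominators cleared, \<open>Y\<close> may vanish.\<close>

lemma norm_diff_i_eq_norm_add_i:
  assumes "X * cnj Y \<in> \<real>"
  shows "norm (X - \<i> * Y) = norm (X + \<i> * Y)"
proof -
  have "Im (X * cnj Y) = 0"
    using assms by (simp add: complex_is_Real_iff)
  then have "(norm (X - \<i> * Y))\<^sup>2 = (norm (X + \<i> * Y))\<^sup>2"
    by (simp only: cmod_power2) (simp add: power2_eq_square algebra_simps)
  then show ?thesis
    by (simp add: power2_eq_iff_nonneg)
qed

text \<open>Inscribed angle theorem for the chord from \<open>- \<i> s\<close> to \<open>\<i> s\<close>.\<close>

lemma chord_product_on_sphere: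
  assumes "z \<in> sphere (of_real a) r" "r\<^sup>2 = a\<^sup>2 + s\<^sup>2"
  shows "(z - \<i> * of_real s) * cnj (z + \<i> * of_real s) = of_real (2 * Re z) * Complex a (- s)"
proof -
  have "(norm (z - of_real a))\<^sup>2 = r\<^sup>2"
    using assms by (simp add: dist_norm norm_minus_commute)
  then have "(Re z)\<^sup>2 + (Im z)\<^sup>2 - 2 * a * Re z = s\<^sup>2"
    unfolding assms(2) by (simp only: cmod_power2) (simp add: power2_eq_square algebra_simps)
  then show ?thesis
    by (simp add: complex_eq_iff power2_eq_square algebra_simps)
qed

lemma crossing_circles_counterexample:
  assumes \<theta>: "\<theta> \<in> {0<..pi/2}" "\<theta> / pi \<in> \<rat>"
  shows "\<exists>f g a1 r1 a2 r2.
         f holomorphic_on ball 0 1 \<and> g holomorphic_on ball 0 1 \<and>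
         circle_in_disc a1 r1 \<and> circle_in_disc a2 r2 \<and> (a1, r1) \<noteq> (a2, r2) \<and>
         config5 a1 r1 a2 r2 \<theta> \<and>
         (\<forall>z \<in> sphere a1 r1 \<union> sphere a2 r2. norm (f z) = norm (g z)) \<and>
         \<not> unimodular_multiple f g"
proof -
  \<comment> \<open>The centres will be \<open>a\<close> and \<open>- a\<close>, the radii 1/4, the
    common points \<open>\<i> * s\<close> and \<open>- \<i> * s\<close>. Each radius there makes the
    angle \<open>\<theta> / 2\<close> with the imaginary axis.\<close>
  define a where "a = sin (\<theta> / 2) / 4"
  define s where "s = cos (\<theta> / 2) / 4"
  have pos: "0 < a" "0 < s"
    using \<theta>(1) unfolding a_def s_def by (auto intro!: sin_gt_zero cos_gt_zero)
  have r: "(1/4)\<^sup>2 = a\<^sup>2 + s\<^sup>2"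
    by (simp add: a_def s_def power_divide flip: add_divide_distrib)
  have le: "a \<le> 1/4" "s \<le> 1/4"
    by (auto simp: a_def s_def)
  have cos\<theta>: "s\<^sup>2 - a\<^sup>2 = cos \<theta> / 16"
    using cos_double[of "\<theta> / 2"] by (simp add: a_def s_def power_divide diff_divide_distrib)
  have rat: "\<exists>m q :: int. q > 0 \<and> \<theta> * of_int q = of_int m * pi"
  proof -
    obtain m q :: int where "q > 0" "\<theta> / pi = of_int m / of_int q"
      using \<theta>(2) by (metis Rats_cases')
    then show ?thesis
      by (intro exI[of _ m] exI[of _ q]) (simp add: field_simps)
  qed
  then obtain m :: int and q :: nat where q: "q > 0" "\<theta> * of_nat q = of_int m * pi"
    by (metis of_int_of_nat_eq zero_less_imp_eq_int)
  define p where "p = \<i> * of_real s"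
  have np: "norm p = s" "- p \<noteq> p" "p \<noteq> 0"
    using pos by (auto simp: p_def norm_mult complex_eq_iff)
  \<comment> \<open>The map \<open>(z - p) / (z + p)\<close> sends the common points to 0 and
    infinity. Multiplication by \<open>\<alpha>\<close> turns the image of the circle about
    \<open>- a\<close> into the real axis and that of the other into the line of direction
    \<open>cis \<theta>\<close>; \<open>X / Y\<close> is the \<open>q\<close>-th power of the
    result.\<close>
  define \<alpha> where "\<alpha> = \<i> * cis (\<theta> / 2)"
  define X where "X z = (\<alpha> * (z - p)) ^ q" for z
  define Y where "Y z = (z + p) ^ q" for z
  have XY0: "X p = 0" "Y (- p) = 0"
    using q by (simp_all add: X_def Y_def)
  have XYnz: "X (- p) \<noteq> 0" "Y p \<noteq> 0"
    using np by (auto simp: X_def Y_def \<alpha>_def)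
  have real: "X z * cnj (Y z) \<in> \<real>" if z: "z \<in> sphere (of_real a) (1/4) \<union> sphere (of_real (- a)) (1/4)" for z
  proof -
    define w where "w = \<alpha> * ((z - p) * cnj (z + p))"
    have "\<exists>\<beta>::complex. \<exists>t::real. w = of_real t * \<beta> \<and> \<beta> ^ q \<in> \<real>"
    proof (cases "z \<in> sphere (of_real a) (1/4)")
      case True
      have "w = of_real (2 * Re z) * (\<alpha> * Complex a (- s))"
        using chord_product_on_sphere[OF True r] by (simp add: w_def p_def mult_ac)
      also have "\<alpha> * Complex a (- s) = of_real (1/4) * cis \<theta>"
      proof -
        have "Complex a (- s) = of_real (1/4) * (- \<i> * cis (\<theta> / 2))"
          by (simp add: complex_eq_iff a_def s_def)
        moreover have "cis \<theta> = cis (\<theta> / 2) * cis (\<theta> / 2)"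
          by (simp add: cis_mult)
        ultimately show ?thesis
          by (simp add: \<alpha>_def algebra_simps)
      qed
      finally have "w = of_real (2 * Re z * (1/4)) * cis \<theta>"
        by simp
      moreover have "cis \<theta> ^ q \<in> \<real>"
        using q(2) by (auto simp: Complex.DeMoivre complex_is_Real_iff sin_zero_iff_int2 mult.commute)
      ultimately show ?thesis
        by blast
    next
      case False
      with z have "z \<in> sphere (of_real (- a)) (1/4)" by simp
      then have "w = of_real (2 * Re z) * (\<alpha> * Complex (- a) (- s))"
        using chord_product_on_sphere[of z "- a" "1/4" s] r by (simp add: w_def p_def mult_ac)
      also have "\<alpha> * Complex (- a) (- s) = of_real (1/4) * 1"
      proof -
        have "Complex (- a) (- s) = of_real (1/4) * (- \<i> * cis (- (\<theta> / 2)))"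
          by (simp add: complex_eq_iff a_def s_def)
        moreover have "cis (\<theta> / 2) * cis (- (\<theta> / 2)) = 1"
          by (simp add: cis_mult)
        ultimately show ?thesis
          by (simp add: \<alpha>_def mult_ac)
      qed
      finally have "w = of_real (2 * Re z * (1/4)) * 1"
        by simp
      then show ?thesis
        by (metis Reals_1 power_one)
    qed
    then have "w ^ q \<in> \<real>"
      by (auto simp: power_mult_distrib)
    moreover have "X z * cnj (Y z) = w ^ q"
      by (simp add: X_def Y_def w_def power_mult_distrib mult_ac)
    ultimately show ?thesis
      by simp
  qed
  define f where "f z = X z - \<i> * Y z" for z
  define g where "g z = X z + \<i> * Y z" for z
  have in_disc: "circle_in_disc (of_real t) (1/4)" if "\<bar>t\<bar> \<le> 1/4" for t :: real
  proof -
    have "norm z < 1" if "z \<in> sphere (of_real t) (1/4)" for z :: complex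
      using that \<open>\<bar>t\<bar> \<le> 1/4\<close> norm_triangle_ineq2[of z "of_real t"]
      by (simp add: dist_norm norm_minus_commute)
    then show ?thesis
      by (auto simp: circle_in_disc_def)
  qed
  have inter: "sphere (of_real a) (1/4) \<inter> sphere (of_real (- a)) (1/4) = {p, - p}"
  proof -
    have *: "z \<in> sphere (of_real t) (1/4) \<longleftrightarrow> (Re z - t)\<^sup>2 + (Im z)\<^sup>2 = a\<^sup>2 + s\<^sup>2" for z t
    proof -
      have "z \<in> sphere (of_real t) (1/4) \<longleftrightarrow> norm (z - of_real t) = 1/4"
        by (simp add: dist_norm norm_minus_commute)
      also have "\<dots> \<longleftrightarrow> (norm (z - of_real t))\<^sup>2 = (1/4)\<^sup>2"
        by (subst power2_eq_iff_nonneg) auto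
      finally show ?thesis
        unfolding r by (simp add: cmod_power2)
    qed
    have **: "(x - a)\<^sup>2 + y\<^sup>2 = a\<^sup>2 + s\<^sup>2 \<and> (x - - a)\<^sup>2 + y\<^sup>2 = a\<^sup>2 + s\<^sup>2 \<longleftrightarrow> x = 0 \<and> y\<^sup>2 = s\<^sup>2" for x y
    proof
      assume h: "(x - a)\<^sup>2 + y\<^sup>2 = a\<^sup>2 + s\<^sup>2 \<and> (x - - a)\<^sup>2 + y\<^sup>2 = a\<^sup>2 + s\<^sup>2"
      moreover have "(x - - a)\<^sup>2 - (x - a)\<^sup>2 = 4 * (a * x)"
        by (simp add: power2_eq_square algebra_simps)
      ultimately have "a * x = 0"
        by (elim conjE) linarith
      with pos h show "x = 0 \<and> y\<^sup>2 = s\<^sup>2"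
        by simp
    qed auto
    have "z \<in> sphere (of_real a) (1/4) \<inter> sphere (of_real (- a)) (1/4) \<longleftrightarrow> Re z = 0 \<and> (Im z)\<^sup>2 = s\<^sup>2" for z
      using * ** by blast
    also have "\<dots> z \<longleftrightarrow> z \<in> {p, - p}" for z
      by (auto simp: p_def complex_eq_iff power2_eq_iff)
    finally show ?thesis
      by blast
  qed
  have angle: "circle_angle (of_real a) (1/4) (of_real (- a)) (1/4) z = \<theta>" if "z \<in> {p, - p}" for z
  proof -
    have "Re ((z - of_real a) * cnj (z - of_real (- a))) = cos \<theta> / 16"
      using that cos\<theta> by (auto simp: p_def power2_eq_square)
    moreover have "cos \<theta> \<ge> 0"
      using \<theta>(1) by (intro cos_ge_zero) auto
    ultimately show ?thesis
      unfolding circle_angle_def using \<theta>(1) by (simp add: arccos_cos)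
  qed
  have "config5 (of_real a) (1/4) (of_real (- a)) (1/4) \<theta>"
    unfolding config5_def circles_two_points_def inter using \<theta>(1) angle np by auto
  moreover have "\<not> unimodular_multiple f g"
  proof
    assume "unimodular_multiple f g"
    then obtain c where c: "\<And>z. z \<in> ball 0 1 \<Longrightarrow> f z = c * g z"
      unfolding unimodular_multiple_def by blast
    \<comment> \<open>At \<open>p\<close> only \<open>Y\<close> survives, so \<open>f = - g\<close>;
      at \<open>- p\<close> only \<open>X\<close> survives, so \<open>f = g\<close>. No single
      factor does both.\<close>
    have "p \<in> ball 0 1" "- p \<in> ball 0 1"
      using np le by auto
    from c[OF this(1)] c[OF this(2)] have "c = - 1" "c = 1"
      using XY0 XYnz by (auto simp: f_def g_def neg_equal_iff_equal)
    then show False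
      by simp
  qed
  moreover have "f holomorphic_on ball 0 1" "g holomorphic_on ball 0 1"
    unfolding f_def g_def X_def Y_def by (intro holomorphic_intros)+
  moreover have "circle_in_disc (of_real a) (1/4)" "circle_in_disc (of_real (- a)) (1/4)"
    using le pos by (intro in_disc; simp)+
  moreover have "norm (f z) = norm (g z)" if "z \<in> sphere (of_real a) (1/4) \<union> sphere (of_real (- a)) (1/4)" for z
    unfolding f_def g_def by (rule norm_diff_i_eq_norm_add_i[OF real[OF that]])
  moreover have "(of_real a :: complex, 1/4 :: real) \<noteq> (of_real (- a), 1/4)"
    using pos by (auto simp: complex_eq_iff)
  ultimately show ?thesis
    by blast
qed

theorem theorem2p16:
  shows
  "(\<forall>f g a1 r1 a2 r2.
      f holomorphic_on ball 0 1 \<and> g holomorphic_on ball 0 1 \<and>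
      circle_in_disc a1 r1 \<and> circle_in_disc a2 r2 \<and> (a1, r1) \<noteq> (a2, r2) \<and>
      (\<forall>z \<in> sphere a1 r1 \<union> sphere a2 r2. norm (f z) = norm (g z)) \<and>
      (config1 a1 r1 a2 r2 \<or> config1 a2 r2 a1 r1 \<or>
       config2 a1 r1 a2 r2 \<or> config2 a2 r2 a1 r1 \<or>
       config3 a1 r1 a2 r2 \<or> config3 a2 r2 a1 r1 \<or>
       config4 a1 r1 a2 r2 \<or> config4 a2 r2 a1 r1 \<or>
       (\<exists>\<theta>. config5 a1 r1 a2 r2 \<theta> \<and> \<theta> / pi \<notin> \<rat>))
      \<longrightarrow> unimodular_multiple f g)
   \<and>
   (\<forall>\<theta>. \<theta> \<in> {0<..pi/2} \<and> \<theta> / pi \<in> \<rat> \<longrightarrow>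
      (\<exists>f g a1 r1 a2 r2.
         f holomorphic_on ball 0 1 \<and> g holomorphic_on ball 0 1 \<and>
         circle_in_disc a1 r1 \<and> circle_in_disc a2 r2 \<and> (a1, r1) \<noteq> (a2, r2) \<and>
         config5 a1 r1 a2 r2 \<theta> \<and>
         (\<forall>z \<in> sphere a1 r1 \<union> sphere a2 r2. norm (f z) = norm (g z)) \<and>
         \<not> unimodular_multiple f g))"
proof (intro conjI allI impI, elim conjE)
  fix f g :: "complex \<Rightarrow> complex" and a1 a2 :: complex and r1 r2 :: real
  assume main: "f holomorphic_on ball 0 1" "g holomorphic_on ball 0 1"
    "circle_in_disc a1 r1" "circle_in_disc a2 r2" "(a1, r1) \<noteq> (a2, r2)"
    "\<forall>z \<in> sphere a1 r1 \<union> sphere a2 r2. norm (f z) = norm (g z)"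
    and "config1 a1 r1 a2 r2 \<or> config1 a2 r2 a1 r1 \<or>
       config2 a1 r1 a2 r2 \<or> config2 a2 r2 a1 r1 \<or>
       config3 a1 r1 a2 r2 \<or> config3 a2 r2 a1 r1 \<or>
       config4 a1 r1 a2 r2 \<or> config4 a2 r2 a1 r1 \<or>
       (\<exists>\<theta>. config5 a1 r1 a2 r2 \<theta> \<and> \<theta> / pi \<notin> \<rat>)"
  then have "circles_disjoint a1 r1 a2 r2 \<or> circles_tangent a1 r1 a2 r2 \<or>
      (\<exists>\<theta>. config5 a1 r1 a2 r2 \<theta> \<and> \<theta> / pi \<notin> \<rat>)"
    unfolding config1_def config2_def config3_def config4_def circles_disjoint_def circles_tangent_def
    by (metis Int_commute)
  with main show "unimodular_multiple f g"
    by (rule unimodular_multiple_if_norm_eq_on_circles)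
qed (elim conjE, rule crossing_circles_counterexample)

end
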